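(* Let $A$ and $B$ be irreducible, non-permutation square matrices with entries in $\{0,1\}$. The one-sided topological Markov shifts $(X_A,\sigma_A)$ and $(X_B,\sigma_B)$ are topologically conjugate if and only if there exists an isomorphism $\varphi:G_A\to G_B$ of étale groupoids such that $\varphi(G_{A,g\circ h})=G_{B,g}$ for all $g\in C(X_B,\mathbb{Z})$, where $h:X_A\to X_B$ is the homeomorphism defined by the restriction of $\varphi$ to the unit space $G_A^{(0)}$ under the identifications of $G_A^{(0)}$ with $X_A$ and of $G_B^{(0)}$ with $X_B$.
   Context: For an $N\times N$ matrix $A$ with entries in $\{0,1\}$, $X_A=\{(x_n)_{n\in\mathbb{N}}\in\{1,\dots,N\}^{\mathbb{N}} : A(x_n,x_{n+1})=1 \text{ for all } n\in\mathbb{N}\}$ with the relative product topology, and $\sigma_A((x_n)_n)=(x_{n+1})_n$. Topological conjugacy of $(X_A,\sigma_A)$ and $(X_B,\sigma_B)$ means existence of a homeomorphism $h:X_A\to X_B$ with $h\circ\sigma_A=\sigma_B\circ h$. $C(X_A,\mathbb{Z})$ is the set of integer-valued continuous functions on $X_A$; $\mathbb{Z}_+$ is the set of nonnegative integers. For $f\in C(X_A,\mathbb{Z})$ and $n\ge1$, $f^n(x)=\sum_{i=0}^{n-1}f(\sigma_A^i(x))$, and $f^0\equiv0$. $G_A$ is the set of $(x,n,z)\in X_A\times\mathbb{Z}\times X_A$ such that there are $k,l\in\mathbb{Z}_+$ with $n=k-l$, $\sigma_A^k(x)=\sigma_A^l(z)$; $s(x,n,z)=(z,0,z)$, $r(x,n,z)=(x,0,x)$,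 $(x,n,z)(z,m,w)=(x,n+m,w)$, $(x,n,z)^{-1}=(z,-n,x)$. A basis of its topology is given by the sets $\{(y,k-l,w)\in G_A: y\in U, w\in V,\sigma_A^k(y)=\sigma_A^l(w)\}$ for $k,l\in\mathbb{Z}_+$ and open $U,V\subset X_A$ such that $\sigma_A^k|_U$, $\sigma_A^l|_V$ are injective. Its unit space $G_A^{(0)}=\{(x,0,x):x\in X_A\}$ is identified with $X_A$. The cocycle groupoid $G_{A,f}\subset G_A$ is the set of $(x,n,z)$ such that there are $k,l\in\mathbb{Z}_+$ with $n=k-l$, $\sigma_A^k(x)=\sigma_A^l(z)$ and $f^k(x)=f^l(z)$. An isomorphism of étale groupoids is a groupoid isomorphism that is a homeomorphism. *)

theory Defs
  imports "HOL-Analysis.Analysis"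
begin

section \<open>Matrices\<close>

text \<open>A square matrix is indexed by a finite type, which plays the role of the alphabet
  \<open>{1, \<dots>, N}\<close> with \<open>N = CARD('n) \<ge> 1\<close>.\<close>

definition zero_one_matrix :: "int^'n^'n \<Rightarrow> bool" where
  "zero_one_matrix A \<longleftrightarrow> (\<forall>i j. A $ i $ j \<in> {0, 1})"

text \<open>The instance of \<^const>\<open>power\<close> on vectors is componentwise, so the matrix power is
  written as an iterated matrix product.\<close>

definition matrix_power :: "int^'n^'n \<Rightarrow> nat \<Rightarrow> int^'n^'n" where
  "matrix_power A n = (((**) A) ^^ n) (mat 1)"

text \<open>The exponent is positive; thus the \<open>1 \<times> 1\<close> zero matrix is not irreducible.\<close>

definition irreducible_matrix :: "int^'n^'n \<Rightarrow> bool" where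
  "irreducible_matrix A \<longleftrightarrow> (\<forall>i j. \<exists>n\<ge>1. matrix_power A n $ i $ j > 0)"

definition permutation_matrix :: "int^'n^'n \<Rightarrow> bool" where
  "permutation_matrix A \<longleftrightarrow>
     (\<exists>p. p permutes UNIV \<and> A = (\<chi> i j. if j = p i then 1 else 0))"


section \<open>One-sided topological Markov shifts\<close>

text \<open>Sequences are indexed from 0.\<close>

definition markov_space :: "int^'n^'n \<Rightarrow> (nat \<Rightarrow> 'n) set" where
  "markov_space A = {x. \<forall>n. A $ x n $ x (Suc n) = 1}"

definition markov_top :: "int^'n^'n \<Rightarrow> (nat \<Rightarrow> 'n) topology" where
  "markov_top A =
     subtopology (product_topology (\<lambda>_. discrete_topology UNIV) UNIV) (markov_space A)"

definition shift :: "(nat \<Rightarrow> 'n) \<Rightarrow> nat \<Rightarrow> 'n" where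
  "shift x = (\<lambda>n. x (Suc n))"

definition topologically_conjugate :: "int^'n^'n \<Rightarrow> int^'m^'m \<Rightarrow> bool" where
  "topologically_conjugate A B \<longleftrightarrow>
     (\<exists>h. homeomorphic_map (markov_top A) (markov_top B) h \<and>
          (\<forall>x \<in> markov_space A. h (shift x) = shift (h x)))"

text \<open>Elements of \<open>C(X\<^sub>A, \<int>)\<close> are represented by functions on all sequences; their values
  outside \<open>X\<^sub>A\<close> are irrelevant.\<close>

definition continuous_integer_functions :: "int^'n^'n \<Rightarrow> ((nat \<Rightarrow> 'n) \<Rightarrow> int) set" where
  "continuous_integer_functions A = {f. continuous_map (markov_top A) (discrete_topology UNIV) f}"

definition birkhoff_sum :: "((nat \<Rightarrow> 'n) \<Rightarrow> int) \<Rightarrow> nat \<Rightarrow> (nat \<Rightarrow> 'n) \<Rightarrow> int" where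
  "birkhoff_sum f n x = (\<Sum>i<n. f ((shift ^^ i) x))"


section \<open>Topological groupoids\<close>

text \<open>The product \<open>a b\<close> is defined when the source of \<open>a\<close> is the range of \<open>b\<close>; units are
  regarded as arrows.\<close>

record 'g top_groupoid =
  arrows :: "'g set"
  source :: "'g \<Rightarrow> 'g"
  range_of :: "'g \<Rightarrow> 'g"
  compose :: "'g \<Rightarrow> 'g \<Rightarrow> 'g"
  inv_of :: "'g \<Rightarrow> 'g"
  arrow_top :: "'g topology"

definition composable :: "'g top_groupoid \<Rightarrow> 'g \<Rightarrow> 'g \<Rightarrow> bool" where
  "composable G a b \<longleftrightarrow> a \<in> arrows G \<and> b \<in> arrows G \<and> source G a = range_of G b"

definition groupoid_hom :: "'g top_groupoid \<Rightarrow> 'k top_groupoid \<Rightarrow> ('g \<Rightarrow> 'k) \<Rightarrow> bool" where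
  "groupoid_hom G H \<phi> \<longleftrightarrow>
     \<phi> ` arrows G \<subseteq> arrows H \<and>
     (\<forall>a b. composable G a b \<longrightarrow>
        composable H (\<phi> a) (\<phi> b) \<and> \<phi> (compose G a b) = compose H (\<phi> a) (\<phi> b)) \<and>
     (\<forall>a \<in> arrows G. \<phi> (inv_of G a) = inv_of H (\<phi> a))"

definition groupoid_iso :: "'g top_groupoid \<Rightarrow> 'k top_groupoid \<Rightarrow> ('g \<Rightarrow> 'k) \<Rightarrow> bool" where
  "groupoid_iso G H \<phi> \<longleftrightarrow>
     bij_betw \<phi> (arrows G) (arrows H) \<and>
     groupoid_hom G H \<phi> \<and> groupoid_hom H G (inv_into (arrows G) \<phi>)"

definition etale_groupoid_iso :: "'g top_groupoid \<Rightarrow> 'k top_groupoid \<Rightarrow> ('g \<Rightarrow> 'k) \<Rightarrow> bool" where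
  "etale_groupoid_iso G H \<phi> \<longleftrightarrow>
     groupoid_iso G H \<phi> \<and> homeomorphic_map (arrow_top G) (arrow_top H) \<phi>"


section \<open>The groupoid of a topological Markov shift\<close>

type_synonym 'n markov_arrow = "(nat \<Rightarrow> 'n) \<times> int \<times> (nat \<Rightarrow> 'n)"

definition markov_arrows :: "int^'n^'n \<Rightarrow> 'n markov_arrow set" where
  "markov_arrows A =
     {(x, n, z). x \<in> markov_space A \<and> z \<in> markov_space A \<and>
        (\<exists>k l. n = int k - int l \<and> (shift ^^ k) x = (shift ^^ l) z)}"

definition markov_basis :: "int^'n^'n \<Rightarrow> 'n markov_arrow set set" where
  "markov_basis A =
     {{(y, n, w). (y, n, w) \<in> markov_arrows A \<and> n = int k - int l \<and> y \<in> U \<and> w \<in> V \<and>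
          (shift ^^ k) y = (shift ^^ l) w} | k l U V.
        openin (markov_top A) U \<and> openin (markov_top A) V \<and>
        inj_on (shift ^^ k) U \<and> inj_on (shift ^^ l) V}"

definition markov_groupoid :: "int^'n^'n \<Rightarrow> 'n markov_arrow top_groupoid" where
  "markov_groupoid A =
     \<lparr>arrows = markov_arrows A,
      source = (\<lambda>(x, n, z). (z, 0, z)),
      range_of = (\<lambda>(x, n, z). (x, 0, x)),
      compose = (\<lambda>(x, n, z) (z', m, w). (x, n + m, w)),
      inv_of = (\<lambda>(x, n, z). (z, - n, x)),
      arrow_top = topology_generated_by (markov_basis A)\<rparr>"

definition cocycle_groupoid ::
    "int^'n^'n \<Rightarrow> ((nat \<Rightarrow> 'n) \<Rightarrow> int) \<Rightarrow> 'n markov_arrow set" where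
  "cocycle_groupoid A f =
     {(x, n, z). x \<in> markov_space A \<and> z \<in> markov_space A \<and>
        (\<exists>k l. n = int k - int l \<and> (shift ^^ k) x = (shift ^^ l) z \<and>
               birkhoff_sum f k x = birkhoff_sum f l z)}"

text \<open>The identification of \<open>X\<^sub>A\<close> with the unit space.\<close>

definition unit_at :: "(nat \<Rightarrow> 'n) \<Rightarrow> 'n markov_arrow" where
  "unit_at x = (x, 0, x)"

definition unit_space_map ::
    "('n markov_arrow \<Rightarrow> 'm markov_arrow) \<Rightarrow> (nat \<Rightarrow> 'n) \<Rightarrow> (nat \<Rightarrow> 'm)" where
  "unit_space_map \<phi> = inv unit_at \<circ> \<phi> \<circ> unit_at"


section \<open>Well-definedness\<close>

lemma inv_unit_at [simp]: "inv unit_at (x, 0, x) = x"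
  by (rule inv_f_eq) (auto simp: unit_at_def inj_def)

lemma unit_at_in_markov_arrows: "x \<in> markov_space A \<Longrightarrow> unit_at x \<in> markov_arrows A"
  unfolding unit_at_def markov_arrows_def by force

lemma unit_space_map:
  assumes "etale_groupoid_iso (markov_groupoid A) (markov_groupoid B) \<phi>" "x \<in> markov_space A"
  shows "unit_space_map \<phi> x \<in> markov_space B" "\<phi> (unit_at x) = unit_at (unit_space_map \<phi> x)"
proof -
  let ?u = "unit_at x"
  have hom: "groupoid_hom (markov_groupoid A) (markov_groupoid B) \<phi>"
    using assms(1) by (simp add: etale_groupoid_iso_def groupoid_iso_def)
  have c: "composable (markov_groupoid A) ?u ?u"
    using unit_at_in_markov_arrows[OF assms(2)]
    by (simp add: composable_def markov_groupoid_def unit_at_def)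
  have uu: "compose (markov_groupoid A) ?u ?u = ?u"
    by (simp add: markov_groupoid_def unit_at_def)
  obtain y n w where e: "\<phi> ?u = (y, n, w)"
    by (cases "\<phi> ?u")
  have "composable (markov_groupoid B) (\<phi> ?u) (\<phi> ?u)"
    and "\<phi> ?u = compose (markov_groupoid B) (\<phi> ?u) (\<phi> ?u)"
    using hom c uu unfolding groupoid_hom_def by metis+
  then have y: "y \<in> markov_space B" and "w = y" "n = 0"
    by (auto simp: e composable_def markov_groupoid_def markov_arrows_def)
  then have "\<phi> ?u = (y, 0, y)"
    by (simp add: e)
  then show "unit_space_map \<phi> x \<in> markov_space B" "\<phi> ?u = unit_at (unit_space_map \<phi> x)"
    using y by (simp_all add: unit_space_map_def unit_at_def)
qed

lemma shift_funpow: "(shift ^^ k) x = (\<lambda>n. x (n + k))"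
  by (induction k) (simp_all add: shift_def)

lemma openin_markov_cylinder: "openin (markov_top A) {y \<in> markov_space A. \<forall>i<k. y i = x i}"
proof -
  have "openin (product_topology (\<lambda>_. discrete_topology UNIV) UNIV)
          (\<Pi>\<^sub>E i\<in>UNIV. if i < k then {x i} else UNIV)"
    by (rule product_topology_basis) (auto intro: finite_subset[of _ "{..<k}"])
  then show ?thesis
    unfolding markov_top_def openin_subtopology
    by (intro exI[of _ "\<Pi>\<^sub>E i\<in>UNIV. if i < k then {x i} else UNIV"])
       (auto simp: PiE_iff split: if_splits)
qed

lemma inj_on_markov_cylinder: "inj_on (shift ^^ k) {y \<in> S. \<forall>i<k. y i = x i}"
proof (rule inj_onI, rule ext)
  fix y z i
  assume "y \<in> {y \<in> S. \<forall>i<k. y i = x i}" "z \<in> {y \<in> S. \<forall>i<k. y i = x i}"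
    and "(shift ^^ k) y = (shift ^^ k) z"
  then show "y i = z i"
    by (cases "i < k") (auto simp: shift_funpow fun_eq_iff dest: spec[of _ "i - k"])
qed

lemma topspace_markov_groupoid: "topspace (arrow_top (markov_groupoid A)) = markov_arrows A"
proof
  show "topspace (arrow_top (markov_groupoid A)) \<subseteq> markov_arrows A"
    by (auto simp: markov_groupoid_def topology_generated_by_topspace markov_basis_def)
  show "markov_arrows A \<subseteq> topspace (arrow_top (markov_groupoid A))"
  proof
    fix a assume a: "a \<in> markov_arrows A"
    then obtain x k l z where e: "a = (x, int k - int l, z)" "x \<in> markov_space A"
        "z \<in> markov_space A" "(shift ^^ k) x = (shift ^^ l) z"
      by (auto simp: markov_arrows_def)
    define U where "U = {y \<in> markov_space A. \<forall>i<k. y i = x i}"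
    define V where "V = {y \<in> markov_space A. \<forall>i<l. y i = z i}"
    let ?Z = "{(y, n, w). (y, n, w) \<in> markov_arrows A \<and> n = int k - int l \<and> y \<in> U \<and> w \<in> V \<and>
                 (shift ^^ k) y = (shift ^^ l) w}"
    have "openin (markov_top A) U \<and> openin (markov_top A) V \<and>
        inj_on (shift ^^ k) U \<and> inj_on (shift ^^ l) V"
      unfolding U_def V_def by (simp add: openin_markov_cylinder inj_on_markov_cylinder)
    then have "?Z \<in> markov_basis A"
      unfolding markov_basis_def by blast
    moreover have "a \<in> ?Z"
      using a e by (simp add: U_def V_def)
    ultimately have "a \<in> \<Union> (markov_basis A)"
      by (rule UnionI)
    then show "a \<in> topspace (arrow_top (markov_groupoid A))"
      by (simp add: markov_groupoid_def topology_generated_by_topspace)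
  qed
qed

end

theory Submission
  imports Defs
begin

text \<open>A conjugacy \<open>h\<close> induces the groupoid isomorphism \<open>(x, n, z) \<mapsto> (h x, n, h z)\<close>, which preserves
  all cocycles. Conversely, given \<open>\<phi>\<close> with unit space map \<open>h\<close>, the arrow \<open>(x, 1, \<sigma> x)\<close> lies in
  \<open>G\<^bsub>A,g\<circ>h\<^esub>\<close> iff \<open>g (h x) = 0\<close>, and its image \<open>(y, k - l, w)\<close>, with \<open>y = h x\<close>, \<open>w = h (\<sigma> x)\<close>
  and \<open>\<sigma>\<^sup>k y = \<sigma>\<^sup>l w\<close>, lies in \<open>G\<^bsub>B,g\<^esub>\<close> iff \<open>g\<^sup>k(y) = g\<^sup>l(w)\<close>. If \<open>y\<close> is not eventually
  periodic, testing this equivalence on indicators of small cylinders forces \<open>w = \<sigma> y\<close>. By Baire's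
  theorem such \<open>y\<close> are dense, because irreducible non-permutation matrices give shift spaces without
  isolated points; so \<open>h \<circ> \<sigma> = \<sigma> \<circ> h\<close> everywhere by continuity.\<close>

section \<open>The shift space\<close>

abbreviation cylinder :: "int^'n^'n \<Rightarrow> (nat \<Rightarrow> 'n) \<Rightarrow> nat \<Rightarrow> (nat \<Rightarrow> 'n) set" where
  "cylinder A x k \<equiv> {y \<in> markov_space A. \<forall>i<k. y i = x i}"

lemma topspace_markov_top [simp]: "topspace (markov_top A) = markov_space A"
  by (simp add: markov_top_def topspace_subtopology)

lemma shift_in_markov_space: "x \<in> markov_space A \<Longrightarrow> shift x \<in> markov_space A"
  by (simp add: markov_space_def shift_def)

lemma shift_funpow_in_markov_space: "x \<in> markov_space A \<Longrightarrow> (shift ^^ k) x \<in> markov_space A"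
  by (simp add: markov_space_def shift_funpow)

text \<open>A basic open set of the product constrains finitely many coordinates; any bound
  \<open>k\<close> on these gives the cylinder.\<close>

lemma openin_markov_top_cylinder:
  assumes "openin (markov_top A) U" "x \<in> U"
  obtains k where "cylinder A x k \<subseteq> U"
proof -
  obtain T where T: "openin (product_topology (\<lambda>_::nat. discrete_topology (UNIV :: 'a set)) UNIV) T"
    and U: "U = T \<inter> markov_space A"
    using assms(1) by (auto simp: markov_top_def openin_subtopology)
  have "x \<in> T"
    using assms(2) U by simp
  then obtain V where V: "finite {i. V i \<noteq> (UNIV :: 'a set)}" "x \<in> Pi\<^sub>E UNIV V" "Pi\<^sub>E UNIV V \<subseteq> T"
    using T unfolding openin_product_topology_alt by auto
  obtain k where k: "\<And>i. V i \<noteq> UNIV \<Longrightarrow> i < k"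
    using V(1) unfolding finite_nat_set_iff_bounded by auto
  have "cylinder A x k \<subseteq> U"
  proof
    fix y assume y: "y \<in> cylinder A x k"
    have "y i \<in> V i" for i
    proof (cases "V i = UNIV")
      case False
      then show ?thesis
        using k[of i] y V(2) by (auto simp: PiE_iff)
    qed simp
    then show "y \<in> U"
      using V(3) y by (auto simp: U PiE_iff)
  qed
  then show ?thesis
    by (rule that)
qed

section \<open>Continuity, separation and compactness\<close>

lemma continuous_map_markov_coordinate:
  "continuous_map (markov_top A) (discrete_topology UNIV) (\<lambda>x. x n)"
  unfolding markov_top_def
  by (intro continuous_map_from_subtopology continuous_map_product_projection) simp

lemma continuous_map_shift_funpow:
  "continuous_map (markov_top A) (markov_top A) (shift ^^ k)"
proof -
  have "continuous_map (markov_top A) (product_topology (\<lambda>_. discrete_topology UNIV) UNIV) (shift ^^ k)"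
    unfolding continuous_map_componentwise_UNIV
    by (simp add: shift_funpow continuous_map_markov_coordinate)
  moreover have "(shift ^^ k) ` markov_space A \<subseteq> markov_space A"
    using shift_funpow_in_markov_space by auto
  ultimately show ?thesis
    by (subst (2) markov_top_def) (auto simp: continuous_map_in_subtopology)
qed

lemma continuous_map_shift: "continuous_map (markov_top A) (markov_top A) shift"
  using continuous_map_shift_funpow[of A 1] by simp

lemma Hausdorff_space_markov_top: "Hausdorff_space (markov_top A)"
  unfolding markov_top_def
  by (intro Hausdorff_space_subtopology) (simp add: Hausdorff_space_product_topology)

text \<open>The complement is the union, over positions \<open>n\<close> and forbidden pairs
  \<open>(a, b)\<close>, of the open sets where \<open>x n = a\<close> and
  \<open>x (Suc n) = b\<close>.\<close>

lemma closedin_markov_space: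
  "closedin (product_topology (\<lambda>_. discrete_topology UNIV) UNIV) (markov_space A)"
proof -
  let ?P = "product_topology (\<lambda>_::nat. discrete_topology (UNIV :: 'a set)) UNIV"
  have "openin ?P {x. x n = a}" for n a
    using openin_continuous_map_preimage[OF continuous_map_product_projection[of n UNIV], of "\<lambda>_. discrete_topology UNIV" "{a}"]
    by simp
  then have "openin ?P (\<Union>n. \<Union>(a, b) \<in> {(a, b). A $ a $ b \<noteq> 1}. {x. x n = a} \<inter> {x. x (Suc n) = b})"
    by (auto intro!: openin_Union openin_Int)
  moreover have "(\<Union>n. \<Union>(a, b) \<in> {(a, b). A $ a $ b \<noteq> 1}. {x. x n = a} \<inter> {x. x (Suc n) = b})
      = topspace ?P - markov_space A"
    by (auto simp: markov_space_def)
  ultimately show ?thesis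
    by (simp add: closedin_def)
qed

lemma compact_space_markov_top: "compact_space (markov_top A)"
  unfolding markov_top_def
  by (intro compact_space_subtopology closedin_compact_space closedin_markov_space)
     (simp add: compact_space_product_topology compact_space_discrete_topology)


section \<open>Aperiodic points are dense\<close>

text \<open>A nonzero entry of a product has a nonzero summand, whose first factor is an edge; the
  induction prepends edges to a path. Working with nonzero entries avoids tracking signs.\<close>

lemma matrix_power_nonzero_trancl:
  fixes A :: "int^'n^'n"
  assumes "zero_one_matrix A" "matrix_power A (Suc n) $ i $ j \<noteq> 0"
  shows "(i, j) \<in> {(i, j). A $ i $ j = 1}\<^sup>+"
  using assms(2)
proof (induction n arbitrary: i)
  case 0
  then have "A $ i $ j \<noteq> 0"
    by (simp add: matrix_power_def)
  then have "A $ i $ j = 1"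
    using assms(1) unfolding zero_one_matrix_def by blast
  then show ?case
    by auto
next
  case (Suc n)
  have "(\<Sum>k\<in>UNIV. A $ i $ k * matrix_power A (Suc n) $ k $ j) \<noteq> 0"
    using Suc.prems by (simp add: matrix_power_def matrix_matrix_mult_def)
  then obtain k where k: "A $ i $ k \<noteq> 0" "matrix_power A (Suc n) $ k $ j \<noteq> 0"
    by (metis (no_types, lifting) mult_eq_0_iff sum.neutral)
  then have "A $ i $ k = 1"
    using assms(1) unfolding zero_one_matrix_def by blast
  then show ?case
    using Suc.IH[OF k(2)] by (auto intro: trancl_into_trancl2)
qed

lemma irreducible_matrix_trancl:
  fixes A :: "int^'n^'n"
  assumes "zero_one_matrix A" "irreducible_matrix A"
  shows "(i, j) \<in> {(i, j). A $ i $ j = 1}\<^sup>+"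
proof -
  obtain n where "n \<ge> 1" "matrix_power A n $ i $ j > 0"
    using assms(2) unfolding irreducible_matrix_def by blast
  then show ?thesis
    using matrix_power_nonzero_trancl[OF assms(1), of "n - 1" i j] by simp
qed

text \<open>If the cylinder were a single point, every state reachable from it would have a unique
  successor; then the successor map is a permutation.\<close>

lemma markov_cylinder_not_singleton:
  fixes A :: "int^'n^'n"
  assumes "zero_one_matrix A" "irreducible_matrix A" "\<not> permutation_matrix A"
    and x: "x \<in> markov_space A"
  obtains y where "y \<in> cylinder A x k" "y \<noteq> x"
proof -
  let ?E = "{(i, j). A $ i $ j = 1}"
  have tr: "(i, j) \<in> ?E\<^sup>+" for i j
    using irreducible_matrix_trancl[OF assms(1,2)] .
  have "\<exists>j. A $ i $ j = 1" for i
    using tr[of i i] by (auto dest: tranclD)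
  then obtain s where s: "\<And>i. A $ i $ s i = 1"
    by metis
  have "\<exists>y\<in>cylinder A x k. y \<noteq> x"
  proof (rule ccontr)
    assume "\<not> ?thesis"
    then have only: "y = x" if "y \<in> markov_space A" "\<And>i. i < k \<Longrightarrow> y i = x i" for y
      using that by blast
    have succ: "j = x (Suc m)" if "m \<ge> k" "A $ x m $ j = 1" for m j
    proof -
      \<comment> \<open>\<open>y\<close> follows \<open>x\<close> up to position \<open>m\<close>,
        moves to \<open>j\<close> at \<open>Suc m\<close> and continues along the chosen successors
        \<open>s\<close>. As \<open>m \<ge> k\<close>, it stays in the cylinder and so equals
        \<open>x\<close>.\<close>
      define y where "y i = (if i \<le> m then x i else (s ^^ (i - Suc m)) j)" for i
      have "A $ y i $ y (Suc i) = 1" for i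
      proof (cases i m rule: linorder_cases)
        case less
        then show ?thesis
          using x by (simp add: y_def markov_space_def)
      next
        case equal
        then show ?thesis
          using that by (simp add: y_def)
      next
        case greater
        then have "Suc i - Suc m = Suc (i - Suc m)"
          by simp
        then show ?thesis
          using greater s by (simp add: y_def)
      qed
      then have "y = x"
        using that(1) by (intro only) (auto simp: markov_space_def y_def)
      then have "y (Suc m) = x (Suc m)"
        by simp
      then show ?thesis
        by (simp add: y_def)
    qed
    \<comment> \<open>Unique successors propagate along paths, so whatever is reachable from
      \<open>x k\<close> occurs in \<open>x\<close> at or after position \<open>k\<close>; by
      irreducibility this is every state.\<close>
    have "\<exists>m\<ge>k. j = x m" for j
      using tr[of "x k" j]
    proof (induction rule: trancl_induct)
      case (base j)
      then show ?case
        using succ[of k j] by (auto intro!: exI[of _ "Suc k"])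
    next
      case (step i j)
      then obtain m where "m \<ge> k" "i = x m"
        by blast
      then show ?case
        using step.hyps(2) succ[of m j] by (auto intro!: exI[of _ "Suc m"])
    qed
    then have uniq: "A $ i $ j = 1 \<longleftrightarrow> j = s i" for i j
      by (metis s succ)
    \<comment> \<open>A closed path through \<open>j\<close> ends with an edge into
      \<open>j\<close>, whose start is a preimage of \<open>j\<close>. Finiteness then gives
      bijectivity.\<close>
    have "surj s"
    proof (unfold surj_def, rule allI)
      fix j
      show "\<exists>i. j = s i"
        using tr[of j j] by (auto dest!: tranclD2 simp: uniq)
    qed
    then have "bij s"
      by (simp add: bij_def finite_UNIV_surj_inj)
    then have "s permutes UNIV"
      by (intro bij_imp_permutes) auto
    moreover have "A = (\<chi> i j. if j = s i then 1 else 0)"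
      using uniq assms(1) by (auto simp: vec_eq_iff zero_one_matrix_def)
    ultimately show False
      using assms(3) unfolding permutation_matrix_def by blast
  qed
  then show ?thesis
    using that by blast
qed

section \<open>Eventually periodic points and Baire category\<close>

lemma periodic_tail_eqI:
  assumes "i < j" "(shift ^^ i) x = (shift ^^ j) x" "(shift ^^ i) y = (shift ^^ j) y"
    and "\<And>n. n < j \<Longrightarrow> x n = y n"
  shows "x = y"
proof
  fix n
  show "x n = y n"
  proof (induction n rule: less_induct)
    case (less n)
    show ?case
    proof (cases "n < j")
      case False
      \<comment> \<open>As \<open>i < j\<close>, position \<open>n - j + i\<close> lies below
        \<open>n\<close>, so the first \<open>j\<close> entries determine all others.\<close>
      then have "x n = x (n - j + i)" "y n = y (n - j + i)"
        using fun_cong[OF assms(2), of "n - j"] fun_cong[OF assms(3), of "n - j"]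
        by (simp_all add: shift_funpow)
      then show ?thesis
        using less[of "n - j + i"] False assms(1) by simp
    qed (rule assms)
  qed
qed

text \<open>Distinctness of all iterates says exactly that \<open>x\<close> is not eventually
  periodic.\<close>

definition aperiodic :: "(nat \<Rightarrow> 'a) \<Rightarrow> bool" where
  "aperiodic x \<longleftrightarrow> inj (\<lambda>i. (shift ^^ i) x)"

text \<open>The other points form the countable union of the closed sets \<open>T (i, j)\<close>
  with \<open>i < j\<close>. These have empty interior because no cylinder is a single point, so by
  Baire's theorem their union contains no nonempty open set.\<close>

lemma exists_aperiodic:
  fixes A :: "int^'n^'n"
  assumes A: "zero_one_matrix A" "irreducible_matrix A" "\<not> permutation_matrix A"
    and U: "openin (markov_top A) U" "U \<noteq> {}"
  obtains x where "x \<in> U" "aperiodic x"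
proof -
  define T where "T = (\<lambda>(i, j). {x \<in> markov_space A. (shift ^^ i) x = (shift ^^ j) x})"
  have cl: "closedin (markov_top A) (T ij)" for ij
    using closedin_continuous_maps_eq[OF Hausdorff_space_markov_top
        continuous_map_shift_funpow continuous_map_shift_funpow, of A "fst ij" "snd ij"]
    by (simp add: T_def case_prod_beta)
  have int: "markov_top A interior_of T (i, j) = {}" if "i < j" for i j
  proof (rule ccontr)
    assume "markov_top A interior_of T (i, j) \<noteq> {}"
    then obtain x where x: "x \<in> markov_top A interior_of T (i, j)"
      by blast
    then obtain k where k: "cylinder A x k \<subseteq> markov_top A interior_of T (i, j)"
      using openin_markov_top_cylinder[OF openin_interior_of x] by blast
    have sub: "markov_top A interior_of T (i, j) \<subseteq> T (i, j)"
      by (rule interior_of_subset)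
    then have xT: "x \<in> T (i, j)"
      using x by blast
    then have "x \<in> markov_space A"
      by (simp add: T_def)
    \<comment> \<open>Length \<open>k\<close> keeps \<open>y\<close> inside \<open>T (i, j)\<close>;
      length \<open>j\<close> lets \<open>periodic_tail_eqI\<close> force
      \<open>y = x\<close>.\<close>
    from markov_cylinder_not_singleton[OF A this, of "max k j"]
    obtain y where y: "y \<in> cylinder A x (max k j)" "y \<noteq> x"
      by blast
    then have "y \<in> T (i, j)"
      using k sub by auto
    then have "y = x"
      using periodic_tail_eqI[OF \<open>i < j\<close>, of y x] xT y(1) by (auto simp: T_def)
    with y(2) show False
      by simp
  qed
  have "markov_top A interior_of \<Union> (T ` {(i, j). i < j}) = {}"
  proof (rule Baire_category_alt)
    show "completely_metrizable_space (markov_top A) \<or>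
        locally_compact_space (markov_top A) \<and> regular_space (markov_top A)"
      by (simp add: compact_space_markov_top compact_imp_locally_compact_space
          Hausdorff_space_markov_top compact_Hausdorff_imp_regular_space)
  qed (use cl int in auto)
  then have "\<not> U \<subseteq> \<Union> (T ` {(i, j). i < j})"
    using interior_of_maximal[OF _ U(1)] U(2) by blast
  then obtain x where x: "x \<in> U" "x \<notin> \<Union> (T ` {(i, j). i < j})"
    by blast
  have "x \<in> markov_space A"
    using openin_subset[OF U(1)] x(1) by auto
  then have "(shift ^^ i) x \<noteq> (shift ^^ j) x" if "i < j" for i j
    using x(2) that by (auto simp: T_def)
  then have "aperiodic x"
    unfolding aperiodic_def by (intro linorder_injI) auto
  with x(1) show ?thesis
    by (rule that)
qed

lemma aperiodicD: "aperiodic x \<Longrightarrow> (shift ^^ i) x = (shift ^^ j) x \<Longrightarrow> i = j"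
  unfolding aperiodic_def inj_def by blast


section \<open>The cocycle of a function\<close>

lemma birkhoff_sum_add:
  "birkhoff_sum f (k + j) x = birkhoff_sum f k x + birkhoff_sum f j ((shift ^^ k) x)"
  by (induction j) (simp_all add: birkhoff_sum_def shift_funpow add.commute add.left_commute)

text \<open>Two representations of the same lag differ by a common increment \<open>j\<close> of
  both exponents. The extra terms are sums of length \<open>j\<close> from the same point, so they
  cancel.\<close>

lemma cocycle_well_defined:
  assumes "int k - int l = int k' - int l'"
    and "(shift ^^ k) x = (shift ^^ l) z" "(shift ^^ k') x = (shift ^^ l') z"
  shows "birkhoff_sum f k x - birkhoff_sum f l z = birkhoff_sum f k' x - birkhoff_sum f l' z"
proof -
  have *: "birkhoff_sum f k x - birkhoff_sum f l z = birkhoff_sum f k' x - birkhoff_sum f l' z"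
    if "k \<le> k'" "int k - int l = int k' - int l'" "(shift ^^ k) x = (shift ^^ l) z" for k l k' l'
  proof -
    obtain j where j: "k' = k + j"
      using \<open>k \<le> k'\<close> le_Suc_ex by blast
    then have "l' = l + j"
      using that(2) by simp
    then show ?thesis
      using j that(3) by (simp add: birkhoff_sum_add)
  qed
  show ?thesis
    using *[of k k' l l'] *[of k' k l' l] assms by (cases "k \<le> k'") auto
qed

text \<open>By \<open>cocycle_well_defined\<close>, the existential over exponents may be tested on
  any one representation.\<close>

lemma in_cocycle_groupoid_iff:
  assumes "x \<in> markov_space A" "z \<in> markov_space A" "(shift ^^ k) x = (shift ^^ l) z"
  shows "(x, int k - int l, z) \<in> cocycle_groupoid A f \<longleftrightarrow> birkhoff_sum f k x = birkhoff_sum f l z"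
proof
  assume "(x, int k - int l, z) \<in> cocycle_groupoid A f"
  then obtain k' l' where "int k - int l = int k' - int l'" "(shift ^^ k') x = (shift ^^ l') z"
    "birkhoff_sum f k' x = birkhoff_sum f l' z"
    unfolding cocycle_groupoid_def by auto
  then show "birkhoff_sum f k x = birkhoff_sum f l z"
    using cocycle_well_defined[OF _ assms(3), of k' l' f] by simp
qed (use assms in \<open>auto simp: cocycle_groupoid_def\<close>)

lemma cocycle_groupoid_subset: "cocycle_groupoid A f \<subseteq> markov_arrows A"
  by (auto simp: cocycle_groupoid_def markov_arrows_def)

section \<open>Integer-valued functions separating points\<close>

lemma cylinder_indicator_continuous:
  "(\<lambda>z. if \<forall>i<N. z i = w i then 1 else 0) \<in> continuous_integer_functions A"
proof -
  define g where "g = (\<lambda>z. if \<forall>i<N. z i = w i then 1 else (0::int))"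
  have "openin (markov_top A) {x \<in> markov_space A. g x \<in> S}" for S
  proof (subst openin_subopen, intro ballI)
    fix x assume x: "x \<in> {x \<in> markov_space A. g x \<in> S}"
    have "cylinder A x N \<subseteq> {x \<in> markov_space A. g x \<in> S}"
    proof
      fix y assume y: "y \<in> cylinder A x N"
      then have "(\<forall>i<N. y i = w i) \<longleftrightarrow> (\<forall>i<N. x i = w i)"
        by auto
      then have "g y = g x"
        by (simp add: g_def)
      then show "y \<in> {x \<in> markov_space A. g x \<in> S}"
        using x y by simp
    qed
    then show "\<exists>T. openin (markov_top A) T \<and> x \<in> T \<and> T \<subseteq> {x \<in> markov_space A. g x \<in> S}"
      using x openin_markov_cylinder[of A N x] by (intro exI[of _ "cylinder A x N"]) simp
  qed
  then have "g \<in> continuous_integer_functions A"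
    by (simp add: continuous_integer_functions_def continuous_map_def)
  then show ?thesis
    by (simp add: g_def)
qed

text \<open>Each \<open>z\<close> in \<open>F\<close> differs from \<open>w\<close> at a coordinate
  \<open>d z\<close>. With \<open>N\<close> above all of these, the indicator of agreement with
  \<open>w\<close> on the first \<open>N\<close> coordinates vanishes on \<open>F\<close>.\<close>

lemma separating_function:
  fixes w :: "nat \<Rightarrow> 'n::finite"
  assumes "finite F" "w \<notin> F"
  obtains g where "g \<in> continuous_integer_functions A" "g w = 1" "\<forall>z\<in>F. g z = 0"
proof -
  have "\<forall>z\<in>F. \<exists>i. z i \<noteq> w i"
    using assms(2) by (metis ext)
  then obtain d where d: "\<And>z. z \<in> F \<Longrightarrow> z (d z) \<noteq> w (d z)"
    by metis
  obtain N where "\<forall>i \<in> d ` F. i < N"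
    using assms(1) finite_nat_set_iff_bounded[of "d ` F"] by auto
  with d have "\<exists>i<N. z i \<noteq> w i" if "z \<in> F" for z
    using that by blast
  then show ?thesis
    by (intro that[OF cylinder_indicator_continuous[of N w A]]) auto
qed

text \<open>The functional \<open>g \<mapsto> g\<^sup>k(y) - g\<^sup>l(w)\<close> is a signed sum of point masses. For minimal \<open>k\<close>
  these sit at distinct points, so the functional can only have the same kernel as the point mass
  at \<open>y\<close> if \<open>k = 1\<close> and \<open>l = 0\<close>.\<close>

lemma eq_shift_if_kernels_agree:
  fixes A :: "int^'n^'n"
  assumes ap: "aperiodic y" and yw: "(y, n, w) \<in> markov_arrows A"
    and ker: "\<And>g. g \<in> continuous_integer_functions A \<Longrightarrow>
                (y, n, w) \<in> cocycle_groupoid A g \<longleftrightarrow> g y = 0"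
  shows "w = shift y"
proof -
  define P where "P k \<longleftrightarrow> (\<exists>l. n = int k - int l \<and> (shift ^^ k) y = (shift ^^ l) w)" for k
  have sp: "y \<in> markov_space A" "w \<in> markov_space A" and "\<exists>k. P k"
    using yw by (auto simp: markov_arrows_def P_def)
  define k where "k = (LEAST k. P k)"
  have "P k"
    unfolding k_def using \<open>\<exists>k. P k\<close> by (rule LeastI_ex)
  then obtain l where n: "n = int k - int l" and kl: "(shift ^^ k) y = (shift ^^ l) w"
    unfolding P_def by blast
  have min: "k \<le> i" if "P i" for i
    unfolding k_def using that by (rule Least_le)
  have ker': "birkhoff_sum g k y = birkhoff_sum g l w \<longleftrightarrow> g y = 0"
    if "g \<in> continuous_integer_functions A" for g
    using ker[OF that] in_cocycle_groupoid_iff[OF sp kl, of g] by (simp add: n)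
  have tail: "(shift ^^ (k + j)) y = (shift ^^ (l + j)) w" for j
    using arg_cong[OF kl, of "shift ^^ j"] by (simp add: funpow_add add.commute)
  have "l = 0"
  proof (rule ccontr)
    assume "l \<noteq> 0"
    \<comment> \<open>For positive \<open>l\<close> the summand \<open>j = 0\<close> puts a point
      mass at \<open>w\<close>. The next facts show that no other evaluation point equals
      \<open>w\<close>, so nothing cancels it.\<close>
    have notw: "(shift ^^ i) y \<noteq> w" if "i < k" for i
    proof
      assume eq: "(shift ^^ i) y = w"
      then have "(shift ^^ (l + i)) y = (shift ^^ k) y"
        by (simp add: funpow_add kl)
      then have "l + i = k"
        by (rule aperiodicD[OF ap])
      \<comment> \<open>The exponents \<open>i\<close> and \<open>0\<close> represent the same
        arrow, against the minimality of \<open>k\<close>.\<close>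
      then have "P i"
        using eq n by (auto simp: P_def intro!: exI[of _ 0])
      then show False
        using min \<open>i < k\<close> by fastforce
    qed
    \<comment> \<open>A periodic \<open>w\<close> would make the tail it shares with
      \<open>y\<close> periodic.\<close>
    have notw': "(shift ^^ j) w \<noteq> w" if "0 < j" for j
    proof
      assume "(shift ^^ j) w = w"
      then have "(shift ^^ (l + j)) w = (shift ^^ l) w"
        by (simp add: funpow_add)
      then have "(shift ^^ (k + j)) y = (shift ^^ k) y"
        using tail[of j] kl by simp
      then show False
        using aperiodicD[OF ap] that by fastforce
    qed
    have "y \<noteq> w"
    proof
      assume "y = w"
      then have "k = l"
        using aperiodicD[OF ap, of k l] kl by simp
      then show False
        using notw[of 0] \<open>l \<noteq> 0\<close> \<open>y = w\<close> by simp
    qed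
    \<comment> \<open>\<open>?F\<close> holds \<open>y\<close> and every evaluation point except
      \<open>w\<close>. Hence \<open>g y = 0\<close>, while the two sums are \<open>0\<close> and
      \<open>1\<close>.\<close>
    let ?F = "insert y ((\<lambda>i. (shift ^^ i) y) ` {..<k} \<union> (\<lambda>j. (shift ^^ j) w) ` {0<..<l})"
    have F: "finite ?F"
      by simp
    have wF: "w \<notin> ?F"
      using \<open>y \<noteq> w\<close> notw[symmetric] notw'[symmetric] by auto
    obtain g where g: "g \<in> continuous_integer_functions A" "g w = 1" "\<forall>z\<in>?F. g z = 0"
      using separating_function[OF F wF, where A = A] .
    have "birkhoff_sum g k y = 0"
      unfolding birkhoff_sum_def by (rule sum.neutral) (use g(3) in auto)
    moreover have "birkhoff_sum g l w = 1"
    proof -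
      have "{..<l} = insert 0 {0<..<l}"
        using \<open>l \<noteq> 0\<close> by auto
      moreover have "(\<Sum>j\<in>{0<..<l}. g ((shift ^^ j) w)) = 0"
        by (rule sum.neutral) (use g(3) in auto)
      ultimately show ?thesis
        using g(2) by (simp add: birkhoff_sum_def)
    qed
    ultimately show False
      using ker'[OF g(1)] g(3) by simp
  qed
  then have w: "w = (shift ^^ k) y"
    using kl by simp
  have "k \<noteq> 0"
  proof
    assume "k = 0"
    \<comment> \<open>With \<open>k = l = 0\<close> both sums are empty, hence equal even for a
      \<open>g\<close> with \<open>g y = 1\<close>.\<close>
    obtain g where "g \<in> continuous_integer_functions A" "g y = 1"
      using separating_function[of "{}" y A] by blast
    with ker'[of g] \<open>k = 0\<close> \<open>l = 0\<close> show False
      by (simp add: birkhoff_sum_def)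
  qed
  moreover have "k \<le> 1"
  proof (rule ccontr)
    assume "\<not> k \<le> 1"
    \<comment> \<open>For \<open>k \<ge> 2\<close> the sum has a term at \<open>shift y\<close>.
      Isolating it from the other orbit points makes the sum \<open>1\<close> although
      \<open>g y = 0\<close>.\<close>
    let ?F = "(\<lambda>i. (shift ^^ i) y) ` ({..<k} - {1})"
    have F: "finite ?F"
      by simp
    have yF: "(shift ^^ 1) y \<notin> ?F"
    proof
      assume "(shift ^^ 1) y \<in> ?F"
      then obtain i where "i \<noteq> 1" "(shift ^^ 1) y = (shift ^^ i) y"
        by blast
      then show False
        using aperiodicD[OF ap] by blast
    qed
    obtain g where g: "g \<in> continuous_integer_functions A" "g ((shift ^^ 1) y) = 1"
        "\<forall>z\<in>?F. g z = 0"
      using separating_function[OF F yF, where A = A] .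
    have "{..<k} = insert 1 ({..<k} - {1})"
      using \<open>\<not> k \<le> 1\<close> by auto
    moreover have "(\<Sum>i\<in>{..<k} - {1}. g ((shift ^^ i) y)) = 0"
      by (rule sum.neutral) (use g(3) in auto)
    ultimately have "birkhoff_sum g k y = 1"
      unfolding birkhoff_sum_def using g(2)
      by (metis (no_types, lifting) Diff_iff add.right_neutral finite_Diff finite_lessThan insertCI sum.insert)
    moreover have "(shift ^^ 0) y \<in> ?F"
      by (rule imageI) (use \<open>\<not> k \<le> 1\<close> in auto)
    then have "g ((shift ^^ 0) y) = 0"
      using g(3) by blast
    ultimately show False
      using ker'[OF g(1)] \<open>l = 0\<close> by (simp add: birkhoff_sum_def)
  qed
  ultimately have "k = 1"
    by simp
  with w show ?thesis
    by simp
qed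


section \<open>The groupoid map of a conjugacy\<close>

lemma markov_groupoid_simps [simp]:
  "arrows (markov_groupoid A) = markov_arrows A"
  "source (markov_groupoid A) (x, n, z) = (z, 0, z)"
  "range_of (markov_groupoid A) (x, n, z) = (x, 0, x)"
  "compose (markov_groupoid A) (x, n, z) (z', m, w) = (x, n + m, w)"
  "inv_of (markov_groupoid A) (x, n, z) = (z, - n, x)"
  "arrow_top (markov_groupoid A) = topology_generated_by (markov_basis A)"
  by (simp_all add: markov_groupoid_def)

lemma composable_markov_groupoid [simp]:
  "composable (markov_groupoid A) (x, n, z) (z', m, w) \<longleftrightarrow>
     (x, n, z) \<in> markov_arrows A \<and> (z', m, w) \<in> markov_arrows A \<and> z = z'"
  by (auto simp: composable_def)

text \<open>Applying \<open>shift ^^ k'\<close> to the first relation and \<open>shift ^^ l\<close>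
  to the second makes both pass through the same iterate of \<open>z\<close>.\<close>

lemma markov_arrows_compose:
  assumes "(x, n, z) \<in> markov_arrows A" "(z, m, w) \<in> markov_arrows A"
  shows "(x, n + m, w) \<in> markov_arrows A"
proof -
  obtain k l where kl: "n = int k - int l" "(shift ^^ k) x = (shift ^^ l) z"
    using assms(1) by (auto simp: markov_arrows_def)
  obtain k' l' where kl': "m = int k' - int l'" "(shift ^^ k') z = (shift ^^ l') w"
    using assms(2) by (auto simp: markov_arrows_def)
  have "(shift ^^ (k' + k)) x = (shift ^^ k') ((shift ^^ l) z)"
    using kl(2) by (simp add: funpow_add)
  also have "\<dots> = (shift ^^ l) ((shift ^^ k') z)"
    by (metis add.commute comp_apply funpow_add)
  also have "\<dots> = (shift ^^ (l + l')) w"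
    using kl'(2) by (simp add: funpow_add)
  finally have "n + m = int (k' + k) - int (l + l') \<and> (shift ^^ (k' + k)) x = (shift ^^ (l + l')) w"
    using kl(1) kl'(1) by simp
  then have "\<exists>k l. n + m = int k - int l \<and> (shift ^^ k) x = (shift ^^ l) w"
    by blast
  then show ?thesis
    using assms by (simp add: markov_arrows_def)
qed

lemma markov_arrows_inv: "(x, n, z) \<in> markov_arrows A \<Longrightarrow> (z, - n, x) \<in> markov_arrows A"
  by (auto simp: markov_arrows_def) (metis minus_diff_eq)

lemma markov_basisI:
  assumes "openin (markov_top A) U" "openin (markov_top A) V"
    "inj_on (shift ^^ k) U" "inj_on (shift ^^ l) V"
  shows "{(y, n, w). (y, n, w) \<in> markov_arrows A \<and> n = int k - int l \<and>
      y \<in> U \<and> w \<in> V \<and> (shift ^^ k) y = (shift ^^ l) w} \<in> markov_basis A"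
  unfolding markov_basis_def
  by (rule CollectI, intro exI conjI, rule refl) (use assms in auto)

lemma markov_basisE:
  assumes "W \<in> markov_basis A"
  obtains k l U V where
    "W = {(y, n, w). (y, n, w) \<in> markov_arrows A \<and> n = int k - int l \<and>
      y \<in> U \<and> w \<in> V \<and> (shift ^^ k) y = (shift ^^ l) w}"
    "openin (markov_top A) U" "openin (markov_top A) V"
    "inj_on (shift ^^ k) U" "inj_on (shift ^^ l) V"
  using assms unfolding markov_basis_def
  by (elim CollectE exE conjE) (rule that; assumption)

definition arrow_map :: "((nat \<Rightarrow> 'n) \<Rightarrow> (nat \<Rightarrow> 'm)) \<Rightarrow> 'n markov_arrow \<Rightarrow> 'm markov_arrow" where
  "arrow_map h = (\<lambda>(x, n, z). (h x, n, h z))"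

lemma arrow_map_simp [simp]: "arrow_map h (x, n, z) = (h x, n, h z)"
  by (simp add: arrow_map_def)

text \<open>The inverse \<open>h'\<close> is a parameter so that, through \<open>symmetric\<close>,
  each fact about \<open>h\<close> also serves for \<open>h'\<close>.\<close>

locale markov_conjugacy =
  fixes A :: "int^'n^'n" and B :: "int^'m^'m" and h h'
  assumes maps: "homeomorphic_maps (markov_top A) (markov_top B) h h'"
    and equivariant: "x \<in> markov_space A \<Longrightarrow> h (shift x) = shift (h x)"
begin

lemma in_space: "x \<in> markov_space A \<Longrightarrow> h x \<in> markov_space B"
  using maps by (auto simp: homeomorphic_maps_def continuous_map_def)

lemma in_space': "y \<in> markov_space B \<Longrightarrow> h' y \<in> markov_space A"
  using maps by (auto simp: homeomorphic_maps_def continuous_map_def)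

lemma inverse: "x \<in> markov_space A \<Longrightarrow> h' (h x) = x" "y \<in> markov_space B \<Longrightarrow> h (h' y) = y"
  using maps by (auto simp: homeomorphic_maps_def)

lemma symmetric: "markov_conjugacy B A h' h"
proof
  show "homeomorphic_maps (markov_top B) (markov_top A) h' h"
    using maps by (rule homeomorphic_maps_sym[THEN iffD1])
  fix y assume "y \<in> markov_space B"
  then show "h' (shift y) = shift (h' y)"
    by (metis equivariant in_space' inverse shift_in_markov_space)
qed

lemma equivariant_funpow: "x \<in> markov_space A \<Longrightarrow> h ((shift ^^ k) x) = (shift ^^ k) (h x)"
  by (induction k) (simp_all add: equivariant shift_funpow_in_markov_space)

lemma shift_funpow_eq_iff:
  assumes "x \<in> markov_space A" "z \<in> markov_space A"
  shows "(shift ^^ k) (h x) = (shift ^^ l) (h z) \<longleftrightarrow> (shift ^^ k) x = (shift ^^ l) z"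
  using assms by (metis equivariant_funpow inverse(1) shift_funpow_in_markov_space)

lemma arrow_map_in_arrows: "a \<in> markov_arrows A \<Longrightarrow> arrow_map h a \<in> markov_arrows B"
  by (auto simp: markov_arrows_def in_space shift_funpow_eq_iff) blast

lemma arrow_map_inverse: "a \<in> markov_arrows A \<Longrightarrow> arrow_map h' (arrow_map h a) = a"
  by (auto simp: markov_arrows_def inverse)

lemma groupoid_hom_arrow_map:
  "groupoid_hom (markov_groupoid A) (markov_groupoid B) (arrow_map h)"
  using arrow_map_in_arrows by (fastforce simp: groupoid_hom_def)

text \<open>The preimage of a basic set is the basic set with the same exponents over the preimages
  of \<open>U\<close> and \<open>V\<close> under \<open>h\<close>. Injectivity of the iterates
  transfers because \<open>h\<close> is injective and equivariant.\<close>

lemma continuous_map_arrow_map: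
  "continuous_map (arrow_top (markov_groupoid A)) (arrow_top (markov_groupoid B)) (arrow_map h)"
proof -
  have top: "topspace (topology_generated_by (markov_basis C)) = markov_arrows C" for C :: "int^'k^'k"
    using topspace_markov_groupoid[of C] by simp
  have "openin (topology_generated_by (markov_basis A)) (arrow_map h -` W \<inter> markov_arrows A)"
    if basis: "W \<in> markov_basis B" for W
  proof -
    obtain k l U V where W: "W = {(y, n, w). (y, n, w) \<in> markov_arrows B \<and> n = int k - int l \<and>
          y \<in> U \<and> w \<in> V \<and> (shift ^^ k) y = (shift ^^ l) w}"
      and U: "openin (markov_top B) U" and V: "openin (markov_top B) V"
      and inj_U: "inj_on (shift ^^ k) U" and inj_V: "inj_on (shift ^^ l) V"
      using basis by (rule markov_basisE)
    have cont: "continuous_map (markov_top A) (markov_top B) h"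
      using maps by (simp add: homeomorphic_maps_def)
    define pre where "pre S = {x \<in> markov_space A. h x \<in> S}" for S
    have op: "openin (markov_top A) (pre S)" if "openin (markov_top B) S" for S
      using openin_continuous_map_preimage[OF cont that] by (simp add: pre_def)
    have inj: "inj_on (shift ^^ i) (pre S)" if "inj_on (shift ^^ i) S" for i S
    proof (rule inj_onI)
      fix x z assume xz: "x \<in> pre S" "z \<in> pre S" and "(shift ^^ i) x = (shift ^^ i) z"
      then have "(shift ^^ i) (h x) = (shift ^^ i) (h z)"
        by (simp add: pre_def shift_funpow_eq_iff)
      then have "h x = h z"
        by (rule inj_onD[OF that]) (use xz in \<open>auto simp: pre_def\<close>)
      then show "x = z"
        using xz inverse(1) unfolding pre_def by (metis (mono_tags, lifting) mem_Collect_eq)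
    qed
    have "arrow_map h -` W \<inter> markov_arrows A =
        {(y, n, w). (y, n, w) \<in> markov_arrows A \<and> n = int k - int l \<and>
          y \<in> pre U \<and> w \<in> pre V \<and> (shift ^^ k) y = (shift ^^ l) w}"
    proof (intro set_eqI iffI)
      fix a assume "a \<in> arrow_map h -` W \<inter> markov_arrows A"
      moreover from this have "fst a \<in> markov_space A" "snd (snd a) \<in> markov_space A"
        by (auto simp: markov_arrows_def)
      ultimately show "a \<in> {(y, n, w). (y, n, w) \<in> markov_arrows A \<and> n = int k - int l \<and>
          y \<in> pre U \<and> w \<in> pre V \<and> (shift ^^ k) y = (shift ^^ l) w}"
        by (cases a) (simp add: W pre_def shift_funpow_eq_iff)
    next
      fix a assume "a \<in> {(y, n, w). (y, n, w) \<in> markov_arrows A \<and> n = int k - int l \<and>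
          y \<in> pre U \<and> w \<in> pre V \<and> (shift ^^ k) y = (shift ^^ l) w}"
      moreover from this have "arrow_map h a \<in> markov_arrows B"
        by (intro arrow_map_in_arrows) auto
      ultimately show "a \<in> arrow_map h -` W \<inter> markov_arrows A"
        by (cases a) (simp add: W pre_def shift_funpow_eq_iff)
    qed
    also have "\<dots> \<in> markov_basis A"
      by (intro markov_basisI op inj U V inj_U inj_V)
    finally show ?thesis
      by (rule topology_generated_by_Basis)
  qed
  moreover have "arrow_map h ` markov_arrows A \<subseteq> \<Union> (markov_basis B)"
    using arrow_map_in_arrows top[of B] by (auto simp: topology_generated_by_topspace)
  ultimately show ?thesis
    unfolding markov_groupoid_simps continuous_on_generated_topo_iff top by blast
qed

lemma homeomorphic_maps_arrow_map:
  "homeomorphic_maps (arrow_top (markov_groupoid A)) (arrow_top (markov_groupoid B))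
     (arrow_map h) (arrow_map h')"
  unfolding homeomorphic_maps_def topspace_markov_groupoid
  using continuous_map_arrow_map markov_conjugacy.continuous_map_arrow_map[OF symmetric]
    arrow_map_inverse markov_conjugacy.arrow_map_inverse[OF symmetric] by blast

lemma bij_betw_arrow_map: "bij_betw (arrow_map h) (markov_arrows A) (markov_arrows B)"
  by (rule bij_betw_byWitness[where f' = "arrow_map h'"])
     (use arrow_map_in_arrows markov_conjugacy.arrow_map_in_arrows[OF symmetric]
        arrow_map_inverse markov_conjugacy.arrow_map_inverse[OF symmetric] in blast)+

lemma etale_groupoid_iso_arrow_map:
  "etale_groupoid_iso (markov_groupoid A) (markov_groupoid B) (arrow_map h)"
proof -
  \<comment> \<open>\<open>inv_into\<close> is known to agree with \<open>arrow_map h'\<close> only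
    on arrows, so products and inverses must be shown to be arrows before rewriting.\<close>
  have inv: "inv_into (markov_arrows A) (arrow_map h) b = arrow_map h' b" if "b \<in> markov_arrows B" for b
    using bij_betw_imp_inj_on[OF bij_betw_arrow_map]
      markov_conjugacy.arrow_map_in_arrows[OF symmetric that]
      markov_conjugacy.arrow_map_inverse[OF symmetric that]
    by (rule inv_into_f_eq)
  have hom': "groupoid_hom (markov_groupoid B) (markov_groupoid A) (arrow_map h')"
    by (rule markov_conjugacy.groupoid_hom_arrow_map[OF symmetric])
  have homD: "composable (markov_groupoid A) (arrow_map h' a) (arrow_map h' b)"
    "arrow_map h' (compose (markov_groupoid B) a b) =
       compose (markov_groupoid A) (arrow_map h' a) (arrow_map h' b)"
    if "composable (markov_groupoid B) a b" for a b
    using hom' that unfolding groupoid_hom_def by blast+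
  have "groupoid_hom (markov_groupoid B) (markov_groupoid A)
      (inv_into (arrows (markov_groupoid A)) (arrow_map h))"
    unfolding groupoid_hom_def
  proof (intro conjI allI impI ballI)
    show "inv_into (arrows (markov_groupoid A)) (arrow_map h) ` arrows (markov_groupoid B)
        \<subseteq> arrows (markov_groupoid A)"
      using inv hom' by (auto simp: groupoid_hom_def)
  next
    fix a b assume c: "composable (markov_groupoid B) a b"
    then have "a \<in> markov_arrows B" "b \<in> markov_arrows B"
      "compose (markov_groupoid B) a b \<in> markov_arrows B"
      by (cases a; cases b; auto simp: composable_def intro: markov_arrows_compose)+
    then show "composable (markov_groupoid A) (inv_into (arrows (markov_groupoid A)) (arrow_map h) a)
          (inv_into (arrows (markov_groupoid A)) (arrow_map h) b)"
      and "inv_into (arrows (markov_groupoid A)) (arrow_map h) (compose (markov_groupoid B) a b) =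
         compose (markov_groupoid A) (inv_into (arrows (markov_groupoid A)) (arrow_map h) a)
          (inv_into (arrows (markov_groupoid A)) (arrow_map h) b)"
      using homD[OF c] by (simp_all add: inv)
  next
    fix a assume a: "a \<in> arrows (markov_groupoid B)"
    then have "inv_of (markov_groupoid B) a \<in> markov_arrows B"
      by (cases a) (auto intro: markov_arrows_inv)
    then show "inv_into (arrows (markov_groupoid A)) (arrow_map h) (inv_of (markov_groupoid B) a) =
         inv_of (markov_groupoid A) (inv_into (arrows (markov_groupoid A)) (arrow_map h) a)"
      using hom' a by (simp add: inv groupoid_hom_def)
  qed
  then show ?thesis
    using bij_betw_arrow_map groupoid_hom_arrow_map
      homeomorphic_maps_imp_map[OF homeomorphic_maps_arrow_map]
    by (simp add: etale_groupoid_iso_def groupoid_iso_def)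
qed

text \<open>An equality on all sequences, which permits rewriting inside
  \<open>g \<circ> unit_space_map \<phi>\<close>.\<close>

lemma unit_space_map_arrow_map: "unit_space_map (arrow_map h) = h"
  by (rule ext) (simp add: unit_space_map_def, simp add: unit_at_def)

section \<open>Cocycle groupoids under a conjugacy\<close>

lemma birkhoff_sum_conjugate:
  "x \<in> markov_space A \<Longrightarrow> birkhoff_sum (g \<circ> h) k x = birkhoff_sum g k (h x)"
  by (simp add: birkhoff_sum_def equivariant_funpow)

lemma arrow_map_in_cocycle_groupoid:
  assumes "a \<in> cocycle_groupoid A (g \<circ> h)"
  shows "arrow_map h a \<in> cocycle_groupoid B g"
  using assms
  by (auto simp: cocycle_groupoid_def in_space shift_funpow_eq_iff birkhoff_sum_conjugate)
     blast

lemma arrow_map_cocycle_groupoid: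
  "arrow_map h ` cocycle_groupoid A (g \<circ> h) = cocycle_groupoid B g"
proof
  show "arrow_map h ` cocycle_groupoid A (g \<circ> h) \<subseteq> cocycle_groupoid B g"
    using arrow_map_in_cocycle_groupoid by blast
  show "cocycle_groupoid B g \<subseteq> arrow_map h ` cocycle_groupoid A (g \<circ> h)"
  proof
    fix b assume b: "b \<in> cocycle_groupoid B g"
    interpret inv: markov_conjugacy B A h' h
      by (rule symmetric)
    obtain x n z where e: "b = (x, n, z)" and sp: "x \<in> markov_space B" "z \<in> markov_space B"
      using b by (auto simp: cocycle_groupoid_def)
    \<comment> \<open>\<open>g \<circ> h \<circ> h'\<close> is known to agree with \<open>g\<close>
      only on the shift space, so the sums are compared at its points.\<close>
    have "birkhoff_sum (g \<circ> h) k (h' y) = birkhoff_sum g k y" if "y \<in> markov_space B" for k y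
      using that by (simp add: birkhoff_sum_conjugate in_space' inverse)
    then have "arrow_map h' b \<in> cocycle_groupoid A (g \<circ> h)"
      using b by (auto simp: cocycle_groupoid_def in_space' inv.shift_funpow_eq_iff) blast
    moreover have "arrow_map h (arrow_map h' b) = b"
      using b cocycle_groupoid_subset by (intro inv.arrow_map_inverse) blast
    ultimately show "b \<in> arrow_map h ` cocycle_groupoid A (g \<circ> h)"
      by (metis image_eqI)
  qed
qed

end


section \<open>The unit space map of an isomorphism\<close>

text \<open>This is the basic set with both exponents \<open>0\<close>, for which injectivity is
  trivial.\<close>

lemma openin_units:
  assumes "openin (markov_top A) U"
  shows "openin (arrow_top (markov_groupoid A)) (unit_at ` U)"
proof -
  have "U \<subseteq> markov_space A"
    using openin_subset[OF assms] by simp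
  then have "unit_at ` U = {(y, n, w). (y, n, w) \<in> markov_arrows A \<and> n = int 0 - int 0 \<and>
      y \<in> U \<and> w \<in> U \<and> (shift ^^ 0) y = (shift ^^ 0) w}"
    using unit_at_in_markov_arrows[of _ A] by (auto simp: unit_at_def)
  also have "\<dots> \<in> markov_basis A"
    using assms by (intro markov_basisI) auto
  finally show ?thesis
    by (simp add: topology_generated_by_Basis)
qed

text \<open>Units have lag \<open>0\<close>, so a basic set pulls back to
  \<open>U \<inter> V\<close> if \<open>k = l\<close> and to the empty set otherwise.\<close>

lemma continuous_map_unit_at: "continuous_map (markov_top A) (arrow_top (markov_groupoid A)) unit_at"
proof -
  have "openin (markov_top A) (unit_at -` W \<inter> markov_space A)" if basis: "W \<in> markov_basis A" for W
  proof -
    obtain k l U V where W: "W = {(y, n, w). (y, n, w) \<in> markov_arrows A \<and> n = int k - int l \<and>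
          y \<in> U \<and> w \<in> V \<and> (shift ^^ k) y = (shift ^^ l) w}"
      and UV: "openin (markov_top A) U" "openin (markov_top A) V"
        "inj_on (shift ^^ k) U" "inj_on (shift ^^ l) V"
      using basis by (rule markov_basisE)
    have "unit_at -` W \<inter> markov_space A = (if k = l then U \<inter> V else {})"
      using openin_subset[OF UV(1)] unit_at_in_markov_arrows[of _ A]
      by (auto simp: W unit_at_def)
    then show ?thesis
      using UV by auto
  qed
  moreover have "unit_at ` markov_space A \<subseteq> \<Union> (markov_basis A)"
    using topspace_markov_groupoid[of A] unit_at_in_markov_arrows
    by (auto simp: topology_generated_by_topspace)
  ultimately show ?thesis
    by (simp add: continuous_on_generated_topo_iff)
qed

lemma inj_unit_at: "inj unit_at"
  by (simp add: inj_def unit_at_def)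

text \<open>A unit is idempotent, hence so is its image; composability with itself equates the
  endpoints, and \<open>n + n = n\<close> gives lag \<open>0\<close>. Applied to the inverse of an
  isomorphism, this yields surjectivity on units.\<close>

lemma groupoid_hom_unit:
  assumes "groupoid_hom (markov_groupoid A) (markov_groupoid B) \<psi>" "x \<in> markov_space A"
  obtains y where "y \<in> markov_space B" "\<psi> (unit_at x) = unit_at y"
proof -
  let ?u = "unit_at x"
  have "composable (markov_groupoid A) ?u ?u" "compose (markov_groupoid A) ?u ?u = ?u"
    using unit_at_in_markov_arrows[OF assms(2)] by (simp_all add: unit_at_def)
  then have "composable (markov_groupoid B) (\<psi> ?u) (\<psi> ?u)"
    "\<psi> ?u = compose (markov_groupoid B) (\<psi> ?u) (\<psi> ?u)"
    using assms(1) unfolding groupoid_hom_def by metis+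
  then show ?thesis
    by (intro that[of "fst (\<psi> ?u)"]; cases "\<psi> ?u") (auto simp: markov_arrows_def unit_at_def)
qed

text \<open>\<open>unit_at\<close> is an open embedding that carries
  \<open>unit_space_map \<phi>\<close> to the restriction of \<open>\<phi>\<close> to units, so
  continuity and openness are inherited from \<open>\<phi>\<close>.\<close>

lemma homeomorphic_map_unit_space_map:
  assumes iso: "etale_groupoid_iso (markov_groupoid A) (markov_groupoid B) \<phi>"
  shows "homeomorphic_map (markov_top A) (markov_top B) (unit_space_map \<phi>)"
proof -
  let ?h = "unit_space_map \<phi>"
  note h = unit_space_map[OF iso]
  have hm: "homeomorphic_map (arrow_top (markov_groupoid A)) (arrow_top (markov_groupoid B)) \<phi>"
    and bij: "bij_betw \<phi> (markov_arrows A) (markov_arrows B)"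
    and inv: "groupoid_hom (markov_groupoid B) (markov_groupoid A) (inv_into (markov_arrows A) \<phi>)"
    using iso by (simp_all add: etale_groupoid_iso_def groupoid_iso_def)
  have "inj_on ?h (markov_space A)"
  proof (rule inj_onI)
    fix x z assume xz: "x \<in> markov_space A" "z \<in> markov_space A" "?h x = ?h z"
    then have "\<phi> (unit_at x) = \<phi> (unit_at z)"
      by (simp add: h)
    then have "unit_at x = unit_at z"
      using xz by (intro inj_onD[OF bij_betw_imp_inj_on[OF bij]] unit_at_in_markov_arrows)
    then show "x = z"
      by (simp add: unit_at_def)
  qed
  moreover have "?h ` markov_space A = markov_space B"
  proof
    show "markov_space B \<subseteq> ?h ` markov_space A"
    proof
      fix y assume y: "y \<in> markov_space B"
      obtain x where x: "x \<in> markov_space A" "inv_into (markov_arrows A) \<phi> (unit_at y) = unit_at x"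
        using groupoid_hom_unit[OF inv y] .
      then have "\<phi> (unit_at x) = unit_at y"
        using bij_betw_inv_into_right[OF bij unit_at_in_markov_arrows[OF y]] by simp
      then have "?h x = y"
        by (simp add: unit_space_map_def inv_f_f[OF inj_unit_at])
      with x show "y \<in> ?h ` markov_space A"
        by blast
    qed
  qed (use h in blast)
  moreover have "continuous_map (markov_top A) (markov_top B) ?h"
    unfolding continuous_map_def
  proof (intro conjI allI impI)
    fix U assume U: "openin (markov_top B) U"
    have "continuous_map (markov_top A) (arrow_top (markov_groupoid B)) (\<phi> \<circ> unit_at)"
      using continuous_map_compose continuous_map_unit_at homeomorphic_imp_continuous_map hm by blast
    from openin_continuous_map_preimage[OF this openin_units[OF U]]
    have "openin (markov_top A) {x \<in> markov_space A. unit_at (?h x) \<in> unit_at ` U}"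
      by (simp add: h(2) cong: conj_cong)
    then show "openin (markov_top A) {x \<in> topspace (markov_top A). ?h x \<in> U}"
      by (simp add: inj_image_mem_iff[OF inj_unit_at])
  qed (use h in auto)
  moreover have "open_map (markov_top A) (markov_top B) ?h"
    unfolding open_map_def
  proof (intro allI impI)
    fix U assume U: "openin (markov_top A) U"
    then have sub: "U \<subseteq> markov_space A"
      using openin_subset by fastforce
    have "openin (arrow_top (markov_groupoid B)) (\<phi> ` unit_at ` U)"
      using homeomorphic_imp_open_map[OF hm] openin_units[OF U] by (simp add: open_map_def)
    from openin_continuous_map_preimage[OF continuous_map_unit_at this]
    have "openin (markov_top B) {y \<in> markov_space B. unit_at y \<in> \<phi> ` unit_at ` U}"
      by simp
    also have "\<phi> ` unit_at ` U = unit_at ` ?h ` U"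
      using h(2) sub by (auto simp: image_image intro!: image_cong)
    also have "{y \<in> markov_space B. unit_at y \<in> unit_at ` ?h ` U} = ?h ` U"
      using h(1) sub by (auto simp: inj_image_mem_iff[OF inj_unit_at])
    finally show "openin (markov_top B) (?h ` U)" .
  qed
  ultimately show ?thesis
    by (intro bijective_open_imp_homeomorphic_map) auto
qed

section \<open>Images of arrows and equivariance at aperiodic points\<close>

lemma etale_groupoid_iso_arrow:
  assumes iso: "etale_groupoid_iso (markov_groupoid A) (markov_groupoid B) \<phi>"
    and a: "(x, n, z) \<in> markov_arrows A"
  obtains m where "\<phi> (x, n, z) = (unit_space_map \<phi> x, m, unit_space_map \<phi> z)"
    "\<phi> (x, n, z) \<in> markov_arrows B"
proof -
  have hom: "groupoid_hom (markov_groupoid A) (markov_groupoid B) \<phi>"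
    using iso by (simp add: etale_groupoid_iso_def groupoid_iso_def)
  have xz: "x \<in> markov_space A" "z \<in> markov_space A"
    using a by (auto simp: markov_arrows_def)
  \<comment> \<open>Composability with the units at both ends survives under \<open>\<phi>\<close>
    and fixes the endpoints of the image; its lag \<open>m\<close> stays undetermined.\<close>
  have "composable (markov_groupoid A) (unit_at x) (x, n, z)"
    "composable (markov_groupoid A) (x, n, z) (unit_at z)"
    using a xz unit_at_in_markov_arrows[of _ A] by (auto simp: unit_at_def)
  then have "composable (markov_groupoid B) (unit_at (unit_space_map \<phi> x)) (\<phi> (x, n, z))"
    "composable (markov_groupoid B) (\<phi> (x, n, z)) (unit_at (unit_space_map \<phi> z))"
    using hom unit_space_map(2)[OF iso xz(1)] unit_space_map(2)[OF iso xz(2)]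
    unfolding groupoid_hom_def by metis+
  then show ?thesis
    by (cases "\<phi> (x, n, z)") (auto simp: unit_at_def intro: that)
qed

lemma unit_space_map_equivariant_aperiodic:
  assumes iso: "etale_groupoid_iso (markov_groupoid A) (markov_groupoid B) \<phi>"
    and coc: "\<And>g. g \<in> continuous_integer_functions B \<Longrightarrow>
            \<phi> ` cocycle_groupoid A (g \<circ> unit_space_map \<phi>) = cocycle_groupoid B g"
    and x: "x \<in> markov_space A" "aperiodic (unit_space_map \<phi> x)"
  shows "unit_space_map \<phi> (shift x) = shift (unit_space_map \<phi> x)"
proof -
  let ?h = "unit_space_map \<phi>"
  \<comment> \<open>With exponents \<open>1\<close> and \<open>0\<close>, the cocycle condition for
    \<open>g \<circ> ?h\<close> compares \<open>g (?h x)\<close> with an empty sum.\<close>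
  have sh: "(shift ^^ 1) x = (shift ^^ 0) (shift x)"
    by simp
  have "\<exists>k l. (1::int) = int k - int l \<and> (shift ^^ k) x = (shift ^^ l) (shift x)"
    by (rule exI[of _ 1], rule exI[of _ 0]) simp
  then have arr: "(x, 1, shift x) \<in> markov_arrows A"
    using x(1) by (simp add: markov_arrows_def shift_in_markov_space)
  obtain m where m: "\<phi> (x, 1, shift x) = (?h x, m, ?h (shift x))"
    "\<phi> (x, 1, shift x) \<in> markov_arrows B"
    using etale_groupoid_iso_arrow[OF iso arr] .
  have inj: "inj_on \<phi> (markov_arrows A)"
    using iso by (simp add: etale_groupoid_iso_def groupoid_iso_def bij_betw_def)
  have "(?h x, m, ?h (shift x)) \<in> cocycle_groupoid B g \<longleftrightarrow> g (?h x) = 0"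
    if "g \<in> continuous_integer_functions B" for g
  proof -
    have "(?h x, m, ?h (shift x)) \<in> cocycle_groupoid B g \<longleftrightarrow>
        \<phi> (x, 1, shift x) \<in> \<phi> ` cocycle_groupoid A (g \<circ> ?h)"
      using coc[OF that] m(1) by simp
    also have "\<dots> \<longleftrightarrow> (x, 1, shift x) \<in> cocycle_groupoid A (g \<circ> ?h)"
      by (rule inj_on_image_mem_iff[OF inj arr cocycle_groupoid_subset])
    also have "\<dots> \<longleftrightarrow> g (?h x) = 0"
      using in_cocycle_groupoid_iff[OF x(1) shift_in_markov_space[OF x(1)] sh, of "g \<circ> ?h"]
      by (simp add: birkhoff_sum_def)
    finally show ?thesis .
  qed
  then show ?thesis
    using eq_shift_if_kernels_agree[OF x(2)] m by metis
qed

section \<open>Conjugacy and cocycle-preserving isomorphism\<close>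

theorem theorem1p5:
  fixes A :: "int^'n^'n" and B :: "int^'m^'m"
  assumes "zero_one_matrix A" and "irreducible_matrix A" and "\<not> permutation_matrix A"
    and "zero_one_matrix B" and "irreducible_matrix B" and "\<not> permutation_matrix B"
  shows "topologically_conjugate A B \<longleftrightarrow>
    (\<exists>\<phi>. etale_groupoid_iso (markov_groupoid A) (markov_groupoid B) \<phi> \<and>
         (\<forall>g \<in> continuous_integer_functions B.
            \<phi> ` cocycle_groupoid A (g \<circ> unit_space_map \<phi>) = cocycle_groupoid B g))"
proof
  assume "topologically_conjugate A B"
  then obtain h where h: "homeomorphic_map (markov_top A) (markov_top B) h"
    "\<forall>x \<in> markov_space A. h (shift x) = shift (h x)"
    unfolding topologically_conjugate_def by blast
  then obtain h' where "homeomorphic_maps (markov_top A) (markov_top B) h h'"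
    unfolding homeomorphic_map_maps by blast
  then interpret markov_conjugacy A B h h'
    using h(2) by unfold_locales auto
  show "\<exists>\<phi>. etale_groupoid_iso (markov_groupoid A) (markov_groupoid B) \<phi> \<and>
         (\<forall>g \<in> continuous_integer_functions B.
            \<phi> ` cocycle_groupoid A (g \<circ> unit_space_map \<phi>) = cocycle_groupoid B g)"
    by (intro exI[of _ "arrow_map h"])
       (simp add: etale_groupoid_iso_arrow_map unit_space_map_arrow_map arrow_map_cocycle_groupoid)
next
  assume "\<exists>\<phi>. etale_groupoid_iso (markov_groupoid A) (markov_groupoid B) \<phi> \<and>
         (\<forall>g \<in> continuous_integer_functions B.
            \<phi> ` cocycle_groupoid A (g \<circ> unit_space_map \<phi>) = cocycle_groupoid B g)"
  then obtain \<phi> where iso: "etale_groupoid_iso (markov_groupoid A) (markov_groupoid B) \<phi>"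
    and coc: "\<And>g. g \<in> continuous_integer_functions B \<Longrightarrow>
            \<phi> ` cocycle_groupoid A (g \<circ> unit_space_map \<phi>) = cocycle_groupoid B g"
    by blast
  define h where "h = unit_space_map \<phi>"
  have hm: "homeomorphic_map (markov_top A) (markov_top B) h"
    unfolding h_def using iso by (rule homeomorphic_map_unit_space_map)
  then have cont: "continuous_map (markov_top A) (markov_top B) h"
    by (rule homeomorphic_imp_continuous_map)
  \<comment> \<open>The equalizer of two continuous maps into a Hausdorff space is closed, so a
    failure of equivariance occurs on an open set.\<close>
  let ?D = "{x \<in> topspace (markov_top A). (h \<circ> shift) x = (shift \<circ> h) x}"
  have "closedin (markov_top A) ?D"
    using continuous_map_compose[OF continuous_map_shift cont]
      continuous_map_compose[OF cont continuous_map_shift]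
    by (rule closedin_continuous_maps_eq[OF Hausdorff_space_markov_top])
  then have op: "openin (markov_top A) (markov_space A - ?D)"
    using openin_diff[OF openin_topspace[of "markov_top A"]] by simp
  have "markov_space A - ?D = {}"
  proof (rule ccontr)
    assume ne: "markov_space A - ?D \<noteq> {}"
    \<comment> \<open>Aperiodicity is wanted for \<open>h x\<close>, so the open set is moved to the
      shift space of \<open>B\<close> and density is applied there.\<close>
    have "openin (markov_top B) (h ` (markov_space A - ?D))"
      using homeomorphic_imp_open_map[OF hm] op unfolding open_map_def by blast
    then obtain y where "y \<in> h ` (markov_space A - ?D)" "aperiodic y"
      using exists_aperiodic[OF assms(4-6)] ne by blast
    then obtain x where x: "x \<in> markov_space A" "x \<notin> ?D" "aperiodic (h x)"
      by blast
    then have "h (shift x) = shift (h x)"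
      using unit_space_map_equivariant_aperiodic[OF iso coc] by (simp add: h_def)
    with x show False
      by simp
  qed
  then have "\<forall>x \<in> markov_space A. h (shift x) = shift (h x)"
    by auto
  with hm show "topologically_conjugate A B"
    unfolding topologically_conjugate_def by blast
qed

end
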